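(* Let $q$ be a prime power and $n\ge 2$ an integer. The minimum distance and the stopping distance of the binary code $\mathcal{C}^T(n,q)$ (with respect to the parity-check matrix $H(n,q)^T$) are both $2q$.
   Context: $\mathbb{S}_n(\mathbb{F}_q)$ denotes the set of $n\times n$ symmetric matrices over $\mathbb{F}_q$ (its elements are called points). Two points $S,S'$ are adjacent if $\operatorname{rank}(S-S')=1$. A line is a maximal set of rank $1$: a subset $\mathcal{M}\subseteq\mathbb{S}_n(\mathbb{F}_q)$ such that any two distinct points of $\mathcal{M}$ are adjacent and no point of $\mathbb{S}_n(\mathbb{F}_q)\setminus\mathcal{M}$ is adjacent to every point of $\mathcal{M}$. $H(n,q)$ is the binary matrix with rows indexed by the lines and columns indexed by the points, whose (line, point) entry is $1$ iff the point belongs to the line. $\mathcal{C}^T(n,q)$ is the binary linear code $\{c\in\mathbb{F}_2^{\text{lines}}: H(n,q)^T c=0\}$. For a binary code given as the null space of a parity-check matrix $H$, a stopping set is a set $T$ of coordinate positions such that no row of $H$ has exactly one $1$ among the positions in $T$; the stopping distance is the minimum size of a nonempty stopping set. *)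

theory Defs
  imports
    "HOL-Analysis.Analysis"
    "HOL-Library.FuncSet"
    "HOL-Library.Z2"
    "HOL-Number_Theory.Prime_Powers"
begin

section \<open>Binary codes given by a parity-check matrix\<close>

text \<open>
  A binary matrix with rows indexed by \<open>R\<close> and columns indexed by \<open>C\<close> is a function
  \<open>H :: 'r \<Rightarrow> 'c \<Rightarrow> bit\<close> of which only the entries on \<open>R \<times> C\<close> matter. A word over the
  coordinate set \<open>C\<close> is an extensional function in \<open>C \<rightarrow>\<^sub>E UNIV\<close>.
\<close>

definition mat_transpose :: "('r \<Rightarrow> 'c \<Rightarrow> bit) \<Rightarrow> 'c \<Rightarrow> 'r \<Rightarrow> bit" where
  "mat_transpose H = (\<lambda>j i. H i j)"

definition null_code :: "'r set \<Rightarrow> 'c set \<Rightarrow> ('r \<Rightarrow> 'c \<Rightarrow> bit) \<Rightarrow> ('c \<Rightarrow> bit) set" where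
  "null_code R C H = {c \<in> C \<rightarrow>\<^sub>E UNIV. \<forall>i\<in>R. (\<Sum>j\<in>C. H i j * c j) = 0}"

definition hamming_dist :: "'c set \<Rightarrow> ('c \<Rightarrow> bit) \<Rightarrow> ('c \<Rightarrow> bit) \<Rightarrow> nat" where
  "hamming_dist C x y = card {j \<in> C. x j \<noteq> y j}"

text \<open>
  Both minima below are infima in \<^typ>\<open>nat\<close>: they are attained unless the set is empty,
  in which case the value is \<open>0\<close>. A positive value therefore entails that the code has two
  distinct words, respectively that a nonempty stopping set exists.
\<close>

definition min_distance :: "'c set \<Rightarrow> ('c \<Rightarrow> bit) set \<Rightarrow> nat" where
  "min_distance C K = Inf {hamming_dist C x y | x y. x \<in> K \<and> y \<in> K \<and> x \<noteq> y}"

definition stopping_set :: "'r set \<Rightarrow> 'c set \<Rightarrow> ('r \<Rightarrow> 'c \<Rightarrow> bit) \<Rightarrow> 'c set \<Rightarrow> bool" where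
  "stopping_set R C H T \<longleftrightarrow> T \<subseteq> C \<and> (\<forall>i\<in>R. card {j \<in> T. H i j = 1} \<noteq> 1)"

definition stopping_distance :: "'r set \<Rightarrow> 'c set \<Rightarrow> ('r \<Rightarrow> 'c \<Rightarrow> bit) \<Rightarrow> nat" where
  "stopping_distance R C H = Inf {card T | T. stopping_set R C H T \<and> T \<noteq> {}}"


section \<open>The geometry of symmetric matrices\<close>

definition sym_points :: "('a::field ^'n^'n) set" where
  "sym_points = {S. transpose S = S}"

definition adjacent :: "'a::field ^'n^'n \<Rightarrow> 'a ^'n^'n \<Rightarrow> bool" where
  "adjacent S S' \<longleftrightarrow> rank (S - S') = 1"

definition is_line :: "('a::field ^'n^'n) set \<Rightarrow> bool" where
  "is_line M \<longleftrightarrow>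
     M \<subseteq> sym_points \<and>
     (\<forall>S\<in>M. \<forall>S'\<in>M. S \<noteq> S' \<longrightarrow> adjacent S S') \<and>
     \<not> (\<exists>P \<in> sym_points - M. \<forall>S\<in>M. adjacent P S)"

definition sym_lines :: "('a::field ^'n^'n) set set" where
  "sym_lines = {M. is_line M}"

definition incidence :: "('a::field ^'n^'n) set \<Rightarrow> 'a ^'n^'n \<Rightarrow> bit" where
  "incidence M P = (if P \<in> M then 1 else 0)"

text \<open>
  The parameters \<open>n\<close> and \<open>q\<close> are carried by the types: \<open>n = CARD('n)\<close>, and \<open>'a\<close> is the
  field with \<open>q = CARD('a)\<close> elements.
\<close>

definition code_T :: "(('a::field ^'n^'n) set \<Rightarrow> bit) set" where
  "code_T = null_code sym_points sym_lines (mat_transpose incidence)"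

end

theory Submission
  imports Defs
begin

text \<open>
  Comparing \<open>2 \<times> 2\<close> minors, \<open>c v v\<^sup>T - d w w\<^sup>T\<close> has rank one only if \<open>v\<close> and \<open>w\<close> are
  proportional. Hence the lines are the sets \<open>P + \<langle>v v\<^sup>T\<rangle>\<close> of size \<open>q\<close>, two lines share at most
  one point, and three pairwise adjacent points lie on a line. A nonempty stopping set contains
  two lines meeting in a point \<open>x\<close>; each of their \<open>2 (q - 1)\<close> points other than \<open>x\<close> needs a further
  line, and these are distinct because there are no triangles. Equality is attained by the \<open>2q\<close>
  lines of the grid \<open>\<langle>e\<^sub>i e\<^sub>i\<^sup>T, e\<^sub>j e\<^sub>j\<^sup>T\<rangle>\<close>, whose points lie on exactly two of them. The support of a
  difference of codewords is a stopping set, and the grid gives a codeword.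
\<close>

section \<open>Symmetric matrices of rank one\<close>

text \<open>The matrix c v v^T; the scalar stays separate because \<open>c\<close> may be a
  nonsquare.\<close>

definition sym_outer :: "'a::field \<Rightarrow> 'a^'n \<Rightarrow> 'a^'n^'n" where
  "sym_outer c v = (\<chi> i j. c * v $ i * v $ j)"

lemma sym_outer_nth [simp]: "sym_outer c v $ i $ j = c * v $ i * v $ j"
  by (simp add: sym_outer_def)

text \<open>Row rank one means that the rows are multiples \<open>u $ i\<close> of one vector
  \<open>w\<close>; this entrywise form gives access to minors and to symmetry.\<close>

lemma rank_eq_1_iff:
  fixes A :: "'a::field^'n^'m"
  shows "rank A = 1 \<longleftrightarrow> A \<noteq> 0 \<and> (\<exists>u w. \<forall>i j. A $ i $ j = u $ i * w $ j)"
proof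
  assume rk: "rank A = 1"
  obtain B where B: "B \<subseteq> rows A" "rows A \<subseteq> vec.span B" "card B = vec.dim (rows A)"
    by (rule vec.basis_exists)
  then obtain b where b: "rows A \<subseteq> vec.span {b}"
    using rk by (auto simp: row_rank_def_gen card_1_singleton_iff)
  have "\<exists>k. row i A = k *s b" for i
    using b by (auto simp: vec.span_singleton rows_def)
  then obtain k where k: "\<And>i. row i A = k i *s b"
    by metis
  have "A $ i $ j = (\<chi> i. k i) $ i * b $ j" for i j
    using k[of i] by (auto simp: row_def vec_eq_iff)
  moreover have "A \<noteq> 0"
  proof
    assume "A = 0"
    then have "rows A \<subseteq> {0}"
      by (auto simp: rows_def row_def vec_eq_iff)
    then show False
      using rk by (metis row_rank_def_gen vec.dim_eq_0 zero_neq_one)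
  qed
  ultimately show "A \<noteq> 0 \<and> (\<exists>u w. \<forall>i j. A $ i $ j = u $ i * w $ j)"
    by blast
next
  assume "A \<noteq> 0 \<and> (\<exists>u w. \<forall>i j. A $ i $ j = u $ i * w $ j)"
  then obtain u w where A: "A \<noteq> 0" "\<And>i j. A $ i $ j = u $ i * w $ j"
    by blast
  have "row i A = u $ i *s w" for i
    by (simp add: row_def vec_eq_iff A(2))
  then have "rows A \<subseteq> vec.span {w}"
    by (auto simp: rows_def vec.span_singleton)
  then have "vec.dim (rows A) \<le> 1"
    using vec.dim_le_card[of "rows A" "{w}"] by simp
  moreover have "vec.dim (rows A) \<noteq> 0"
  proof
    assume "vec.dim (rows A) = 0"
    then have "row i A = 0" for i
      by (auto simp: rows_def vec.dim_eq_0)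
    then show False
      using A(1) by (simp add: row_def vec_eq_iff)
  qed
  ultimately show "rank A = 1"
    unfolding row_rank_def_gen by linarith
qed

lemma rank_eq_1_minor:
  fixes A :: "'a::field^'n^'m"
  assumes "rank A = 1"
  shows "A $ i $ j * A $ k $ l = A $ i $ l * A $ k $ j"
  using assms unfolding rank_eq_1_iff by auto

lemma rank_sym_outer:
  assumes "c \<noteq> 0" "v \<noteq> 0"
  shows "rank (sym_outer c v) = 1"
proof -
  obtain k where "v $ k \<noteq> 0"
    using assms(2) by (auto simp: vec_eq_iff)
  then have "sym_outer c v $ k $ k \<noteq> 0"
    using assms(1) by simp
  then have "sym_outer c v \<noteq> 0"
    by (metis zero_index)
  moreover have "sym_outer c v $ i $ j = (c *s v) $ i * v $ j" for i j
    by simp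
  ultimately show ?thesis
    unfolding rank_eq_1_iff by blast
qed

text \<open>Symmetry reads \<open>u $ i * w $ l = u $ l * w $ i\<close>, so \<open>u\<close> is a
  multiple of \<open>w\<close>; the factor \<open>u $ l / w $ l\<close> becomes the scalar.\<close>

lemma sym_rank_1_outer:
  assumes "transpose A = A" "rank A = 1"
  obtains c v where "c \<noteq> 0" "v \<noteq> 0" "A = sym_outer c v"
proof -
  obtain u w where A: "A \<noteq> 0" "\<And>i j. A $ i $ j = u $ i * w $ j"
    using assms(2) unfolding rank_eq_1_iff by blast
  then obtain k l where "A $ k $ l \<noteq> 0"
    by (auto simp: vec_eq_iff)
  then have "w $ l \<noteq> 0"
    by (simp add: A(2))
  have "u $ i * w $ l = u $ l * w $ i" for i
    using A(2) assms(1) by (metis transpose_def vec_lambda_beta)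
  then have u: "u $ i = u $ l / w $ l * w $ i" for i
    using \<open>w $ l \<noteq> 0\<close> by (simp add: field_simps)
  have "A $ i $ j = sym_outer (u $ l / w $ l) w $ i $ j" for i j
    unfolding A(2) sym_outer_nth by (subst u) (rule refl)
  then have eq: "A = sym_outer (u $ l / w $ l) w"
    by (simp only: vec_eq_iff) simp
  moreover have "u $ l / w $ l \<noteq> 0" "w \<noteq> 0"
    using eq A(1) \<open>w $ l \<noteq> 0\<close> by (auto simp: vec_eq_iff)
  ultimately show thesis
    using that by blast
qed

lemma sym_outer_diff_rank_1_proportional:
  assumes "rank (sym_outer c v - sym_outer d w) = 1" "c \<noteq> 0" "d \<noteq> 0" "v \<noteq> 0"
  obtains r where "w = r *s v"
proof -
  have minor: "v $ i * w $ k = v $ k * w $ i" for i k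
  proof -
    \<comment> \<open>The principal minor of the difference on rows \<open>i\<close> and
      \<open>k\<close> is \<open>- c * d * (v $ i * w $ k - v $ k * w $ i)^2\<close>, in every
      characteristic.\<close>
    have "c * d * (v $ i * w $ k - v $ k * w $ i)^2 = 0"
      using rank_eq_1_minor[OF assms(1), of i i k k]
      by (simp add: algebra_simps power2_eq_square)
    then show ?thesis
      using assms by simp
  qed
  obtain k where "v $ k \<noteq> 0"
    using assms(4) by (auto simp: vec_eq_iff)
  then have "w = (w $ k / v $ k) *s v"
    using minor by (simp add: vec_eq_iff field_simps)
  then show thesis
    using that by blast
qed


section \<open>Lines\<close>

lemma adjacent_sym: "adjacent S S' \<longleftrightarrow> adjacent S' S"
proof -
  have "adjacent S' S" if adj: "adjacent S S'" for S S' :: "'a::field^'n^'n"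
  proof -
    obtain u w where uw: "S - S' \<noteq> 0" "\<And>i j. (S - S') $ i $ j = u $ i * w $ j"
      using adj unfolding adjacent_def rank_eq_1_iff by blast
    have "(S' - S) $ i $ j = (- u) $ i * w $ j" for i j
      using uw(2)[of i j] by (simp add: algebra_simps)
    then show ?thesis
      unfolding adjacent_def rank_eq_1_iff using uw(1) by (metis right_minus_eq)
  qed
  then show ?thesis by blast
qed

lemma not_adjacent_refl [simp]: "\<not> adjacent S S"
  unfolding adjacent_def rank_eq_1_iff by simp

text \<open>The affine line through \<open>P\<close> in direction v v^T; for symmetric
  \<open>P\<close> and nonzero \<open>v\<close> these turn out to be exactly the lines.\<close>

definition sym_line :: "'a::field^'n^'n \<Rightarrow> 'a^'n \<Rightarrow> ('a^'n^'n) set" where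
  "sym_line P v = range (\<lambda>c. P + sym_outer c v)"

lemma sym_line_mem: "P + sym_outer c v \<in> sym_line P v"
  by (simp add: sym_line_def)

lemma sym_line_base: "P \<in> sym_line P v"
proof -
  have "P + sym_outer 0 v = P"
    by (simp add: vec_eq_iff)
  then show ?thesis
    by (metis sym_line_mem)
qed

lemma sym_outer_sym [simp]: "transpose (sym_outer c v) = sym_outer c v"
  by (simp add: vec_eq_iff transpose_def)

lemma sym_points_add: "P \<in> sym_points \<Longrightarrow> Q \<in> sym_points \<Longrightarrow> P + Q \<in> sym_points"
  by (simp add: sym_points_def vec_eq_iff transpose_def)

lemma sym_outer_points [simp]: "sym_outer c v \<in> sym_points"
  by (simp add: sym_points_def)

lemma inj_line_param:
  assumes "v \<noteq> 0"
  shows "inj (\<lambda>c. P + sym_outer c v)"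
proof (rule injI)
  fix c d
  assume "P + sym_outer c v = P + sym_outer d v"
  then have "sym_outer c v $ k $ k = sym_outer d v $ k $ k" for k
    by simp
  then show "c = d"
    using assms by (auto simp: vec_eq_iff)
qed

lemma sym_line_adjacent:
  assumes "v \<noteq> 0" "S \<in> sym_line P v" "S' \<in> sym_line P v" "S \<noteq> S'"
  shows "adjacent S S'"
proof -
  obtain c d where cd: "S = P + sym_outer c v" "S' = P + sym_outer d v"
    using assms by (auto simp: sym_line_def)
  then have "S - S' = sym_outer (c - d) v"
    by (simp add: vec_eq_iff algebra_simps)
  then show ?thesis
    using rank_sym_outer[of "c - d" v] assms cd unfolding adjacent_def by (metis right_minus_eq)
qed

lemma adjacent_points_outer:
  assumes "P \<in> sym_points" "Q \<in> sym_points" "adjacent P Q"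
  obtains c v where "c \<noteq> 0" "v \<noteq> 0" "Q = P + sym_outer c v"
proof -
  have "transpose (Q - P) = Q - P"
    using assms by (simp add: sym_points_def vec_eq_iff transpose_def)
  moreover have "rank (Q - P) = 1"
    using assms(3) adjacent_sym by (metis adjacent_def)
  ultimately obtain c v where "c \<noteq> 0" "v \<noteq> 0" "Q - P = sym_outer c v"
    by (rule sym_rank_1_outer)
  then show thesis
    using that by (metis add.commute diff_add_cancel)
qed

text \<open>Seen from \<open>P\<close>, the point \<open>R\<close> is some d w w^T whose difference
  from c v v^T has rank one, so \<open>w\<close> is proportional to \<open>v\<close>.\<close>

lemma triangle_collinear:
  assumes "P \<in> sym_points" "R \<in> sym_points" "adjacent R P" "adjacent R (P + sym_outer c v)"
    "c \<noteq> 0" "v \<noteq> 0"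
  shows "R \<in> sym_line P v"
proof -
  obtain d w where dw: "d \<noteq> 0" "w \<noteq> 0" "R = P + sym_outer d w"
    using assms adjacent_sym adjacent_points_outer by metis
  have "adjacent (P + sym_outer c v) R"
    using assms adjacent_sym by blast
  then have "rank (sym_outer c v - sym_outer d w) = 1"
    by (simp add: dw(3) adjacent_def)
  then obtain r where "w = r *s v"
    using assms dw by (metis sym_outer_diff_rank_1_proportional)
  then have "sym_outer d w = sym_outer (d * r * r) v"
    by (simp add: vec_eq_iff algebra_simps)
  then show ?thesis
    by (auto simp: sym_line_def dw(3))
qed

lemma is_line_sym_line:
  assumes "P \<in> sym_points" "v \<noteq> 0"
  shows "is_line (sym_line P v)"
  unfolding is_line_def
proof (intro conjI)
  show "sym_line P v \<subseteq> sym_points"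
    using assms by (auto simp: sym_line_def sym_points_add)
  show "\<forall>S\<in>sym_line P v. \<forall>S'\<in>sym_line P v. S \<noteq> S' \<longrightarrow> adjacent S S'"
    using sym_line_adjacent assms by blast
  show "\<not> (\<exists>R\<in>sym_points - sym_line P v. \<forall>S\<in>sym_line P v. adjacent R S)"
  proof
    assume "\<exists>R\<in>sym_points - sym_line P v. \<forall>S\<in>sym_line P v. adjacent R S"
    then obtain R where R: "R \<in> sym_points" "R \<notin> sym_line P v"
      "\<And>S. S \<in> sym_line P v \<Longrightarrow> adjacent R S"
      by auto
    \<comment> \<open>Two points of the line suffice: \<open>P\<close> and the one with parameter
      1.\<close>
    then show False
      using triangle_collinear[OF assms(1) R(1) _ _ one_neq_zero assms(2)] sym_line_base sym_line_mem
      by blast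
  qed
qed

lemma is_line_adjacent:
  "is_line M \<Longrightarrow> S \<in> M \<Longrightarrow> S' \<in> M \<Longrightarrow> S \<noteq> S' \<Longrightarrow> adjacent S S'"
  by (simp add: is_line_def)

lemma is_line_points: "is_line M \<Longrightarrow> S \<in> M \<Longrightarrow> S \<in> sym_points"
  by (auto simp: is_line_def)

lemma is_line_eq_sym_line:
  assumes "is_line M"
  obtains P v where "P \<in> sym_points" "v \<noteq> 0" "M = sym_line P v"
proof -
  have sub: "M \<subseteq> sym_points"
    and adj: "\<And>S S'. S \<in> M \<Longrightarrow> S' \<in> M \<Longrightarrow> S \<noteq> S' \<Longrightarrow> adjacent S S'"
    and maximal: "\<And>P. P \<in> sym_points \<Longrightarrow> (\<And>S. S \<in> M \<Longrightarrow> adjacent P S) \<Longrightarrow> P \<in> M"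
    using assms unfolding is_line_def by blast+
  \<comment> \<open>\<open>M\<close> is nonempty: otherwise \<open>0\<close> would vacuously be
    adjacent to all of \<open>M\<close>, against maximality.\<close>
  have "0 \<in> sym_points"
    by (simp add: sym_points_def vec_eq_iff transpose_def)
  then obtain P where P: "P \<in> M"
    using maximal by blast
  \<comment> \<open>A single point is not maximal: adding e e^T for a unit vector e, here with an
    arbitrary index, gives a neighbour.\<close>
  have "\<exists>Q\<in>M. Q \<noteq> P"
  proof (rule ccontr)
    assume "\<not> (\<exists>Q\<in>M. Q \<noteq> P)"
    then have M: "M = {P}"
      using P by blast
    have "rank (sym_outer 1 (axis undefined 1) :: 'a^'b^'b) = 1"
      by (rule rank_sym_outer) auto
    then have ad: "adjacent (P + sym_outer 1 (axis undefined 1)) P"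
      by (simp add: adjacent_def)
    moreover have "P + sym_outer 1 (axis undefined 1) \<in> sym_points"
      using P sub by (auto intro: sym_points_add)
    ultimately have "P + sym_outer 1 (axis undefined 1) \<in> M"
      using maximal M by blast
    then show False
      using M ad by auto
  qed
  then obtain Q where Q: "Q \<in> M" "Q \<noteq> P" by blast
  obtain c v where cv: "c \<noteq> 0" "v \<noteq> 0" "Q = P + sym_outer c v"
    using adjacent_points_outer[of P Q] adj[of P Q] P Q sub by blast
  have "R \<in> sym_line P v" if "R \<in> M" for R
  proof -
    consider "R = P" | "R = Q" | "R \<noteq> P" "R \<noteq> Q" by blast
    then show ?thesis
    proof cases
      case 1
      then show ?thesis
        by (simp add: sym_line_base)
    next
      case 2
      then show ?thesis
        by (simp add: cv sym_line_mem)
    next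
      case 3
      then show ?thesis
        using triangle_collinear[of P R c v] adj[of R P] adj[of R Q] P Q that sub cv by blast
    qed
  qed
  \<comment> \<open>As \<open>M\<close> lies inside the line, a point of the line missing from
    \<open>M\<close> would be adjacent to all of \<open>M\<close>.\<close>
  moreover have "R \<in> M" if R: "R \<in> sym_line P v" for R
  proof (rule ccontr)
    assume "R \<notin> M"
    then have "adjacent R S" if "S \<in> M" for S
      using sym_line_adjacent[OF cv(2) R] calculation that by blast
    moreover have "R \<in> sym_points"
      using R P sub by (auto simp: sym_line_def intro: sym_points_add)
    ultimately show False
      using maximal \<open>R \<notin> M\<close> by blast
  qed
  ultimately show thesis
    using that[of P v] P sub cv by blast
qed

lemma card_line:
  assumes "is_line (M :: ('a::field^'n^'n) set)"
  shows "card M = CARD('a)"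
proof -
  obtain P v where "v \<noteq> 0" "M = sym_line P v"
    using assms by (rule is_line_eq_sym_line)
  then show ?thesis
    by (simp add: sym_line_def card_image inj_line_param)
qed

text \<open>Moving the base point of the line to \<open>P\<close> gives \<open>Q\<close> a nonzero
  parameter, and \<open>triangle_collinear\<close> applies. This rules out triangles that do not lie
  on a line.\<close>

lemma line_absorbs_common_neighbour:
  assumes "is_line M" "P \<in> M" "Q \<in> M" "P \<noteq> Q" "R \<in> sym_points" "adjacent R P" "adjacent R Q"
  shows "R \<in> M"
proof -
  obtain P0 v where M: "P0 \<in> sym_points" "v \<noteq> 0" "M = sym_line P0 v"
    using assms(1) by (rule is_line_eq_sym_line)
  then obtain c d where cd: "P = P0 + sym_outer c v" "Q = P0 + sym_outer d v"
    using assms by (auto simp: sym_line_def)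
  then have "Q = P + sym_outer (d - c) v"
    by (simp add: vec_eq_iff algebra_simps)
  moreover have "d - c \<noteq> 0"
    using cd assms by auto
  ultimately have "R \<in> sym_line P v"
    using triangle_collinear[of P R "d - c" v] assms M
    by (auto simp: is_line_def)
  then obtain e where "R = P + sym_outer e v"
    by (auto simp: sym_line_def)
  then have "R = P0 + sym_outer (c + e) v"
    by (simp add: cd vec_eq_iff algebra_simps)
  then show ?thesis
    by (auto simp: M sym_line_def)
qed

text \<open>Any further point of one line is a common neighbour of \<open>P\<close> and
  \<open>Q\<close>, hence absorbed by the other line.\<close>

lemma lines_eq:
  assumes "is_line M" "is_line N" "P \<in> M" "Q \<in> M" "P \<in> N" "Q \<in> N" "P \<noteq> Q"
  shows "M = N"
proof -
  have "M \<subseteq> N" if "is_line M" "is_line N" "P \<in> M" "Q \<in> M" "P \<in> N" "Q \<in> N" for M N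
  proof
    fix R assume "R \<in> M"
    then have "adjacent R P" "adjacent R Q" "R \<in> sym_points" if "R \<noteq> P" "R \<noteq> Q"
      using \<open>is_line M\<close> \<open>P \<in> M\<close> \<open>Q \<in> M\<close> that is_line_adjacent is_line_points by blast+
    then show "R \<in> N"
      using that assms(7) line_absorbs_common_neighbour by blast
  qed
  then show ?thesis
    using assms by blast
qed


section \<open>Stopping sets\<close>

lemma stopping_set_card_ge:
  fixes T :: "('a::{field,finite}^'n^'n) set set"
  assumes T: "stopping_set sym_points sym_lines (mat_transpose incidence) T" "T \<noteq> {}"
  shows "2 * CARD('a) \<le> card T"
proof -
  have line: "is_line L" if "L \<in> T" for L
    using T(1) that by (auto simp: stopping_set_def sym_lines_def)
  \<comment> \<open>Were \<open>L\<close> the only line of \<open>T\<close> through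
    \<open>x\<close>, the row of \<open>x\<close> would have exactly one 1 in
    \<open>T\<close>.\<close>
  have other: "\<exists>L'\<in>T. L' \<noteq> L \<and> x \<in> L'" if "L \<in> T" "x \<in> L" for L x
  proof (rule ccontr)
    assume "\<not> ?thesis"
    then have "{M \<in> T. mat_transpose incidence x M = 1} = {L}"
      using that by (auto simp: mat_transpose_def incidence_def split: if_splits)
    moreover have "x \<in> sym_points"
      using line is_line_points that by blast
    ultimately show False
      using T(1) by (auto simp: stopping_set_def)
  qed
  obtain L where L: "L \<in> T" using T(2) by blast
  have "card L > 0"
    using card_line[OF line[OF L]] by simp
  then obtain x where x: "x \<in> L"
    by (metis card_gt_0_iff all_not_in_conv)
  obtain L' where L': "L' \<in> T" "L' \<noteq> L" "x \<in> L'"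
    using other L x by blast
  obtain f where f: "\<And>y. y \<in> L \<Longrightarrow> f y \<in> T \<and> f y \<noteq> L \<and> y \<in> f y"
    using other[OF L] by metis
  obtain g where g: "\<And>y. y \<in> L' \<Longrightarrow> g y \<in> T \<and> g y \<noteq> L' \<and> y \<in> g y"
    using other[OF L'(1)] by metis
  have meet: "y = x" if "y \<in> L" "y \<in> L'" for y
    using lines_eq[of L L' x y] line L L' x that by blast
  \<comment> \<open>If \<open>f\<close> agreed at two points of \<open>L\<close>, its value would
    share both with \<open>L\<close> and equal \<open>L\<close>; likewise for
    \<open>g\<close>.\<close>
  have "inj_on f (L - {x})" "inj_on g (L' - {x})"
    using f g line L L' lines_eq unfolding inj_on_def by (metis DiffD1)+
  then have cf: "card (f ` (L - {x})) = CARD('a) - 1" "card (g ` (L' - {x})) = CARD('a) - 1"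
    using card_line[OF line] L L' x by (simp_all add: card_image)
  \<comment> \<open>A common value \<open>f y = g z\<close> makes \<open>x\<close>,
    \<open>y\<close>, \<open>z\<close> pairwise adjacent, which puts \<open>z\<close> on
    \<open>L\<close>, although \<open>L\<close> and \<open>L'\<close> meet only in
    \<open>x\<close>.\<close>
  have disj: "f ` (L - {x}) \<inter> g ` (L' - {x}) = {}"
  proof (rule ccontr)
    assume "\<not> ?thesis"
    then obtain y z where yz: "y \<in> L" "y \<noteq> x" "z \<in> L'" "z \<noteq> x" "f y = g z"
      by blast
    have fy: "y \<in> f y" "z \<in> f y" "is_line (f y)"
      using yz f g line by metis+
    have "z \<noteq> y" using meet yz by blast
    then have "adjacent z y"
      using is_line_adjacent fy by blast
    moreover have "adjacent z x" "z \<in> sym_points"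
      using is_line_adjacent is_line_points line[OF L'(1)] L'(3) yz(3,4) by blast+
    ultimately have "z \<in> L"
      using line_absorbs_common_neighbour[OF line[OF L] x yz(1)] yz by metis
    then show False using meet yz by blast
  qed
  \<comment> \<open>For instance, \<open>f y = L'\<close> would put \<open>y\<close> on both
    \<open>L\<close> and \<open>L'\<close>, forcing \<open>y = x\<close>.\<close>
  have notin: "L \<notin> f ` (L - {x})" "L' \<notin> g ` (L' - {x})"
    "L' \<notin> f ` (L - {x})" "L \<notin> g ` (L' - {x})"
    using f g meet by fastforce+
  have "card (insert L (insert L' (f ` (L - {x}) \<union> g ` (L' - {x})))) = 2 + 2 * (CARD('a) - 1)"
    using notin L'(2) by (simp add: card_Un_disjoint disj cf)
  moreover have "insert L (insert L' (f ` (L - {x}) \<union> g ` (L' - {x}))) \<subseteq> T"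
    using f g L L' by blast
  ultimately have "2 + 2 * (CARD('a) - 1) \<le> card T"
    by (metis card_mono finite)
  \<comment> \<open>Needed to undo the truncated subtraction in \<open>CARD('a) - 1\<close>.\<close>
  moreover have "CARD('a) > 0"
    by simp
  ultimately show ?thesis
    by linarith
qed

section \<open>Parity and the supports of codewords\<close>

lemma even_card_stopping_set:
  assumes "T \<subseteq> C" "\<And>i. i \<in> R \<Longrightarrow> even (card {j \<in> T. H i j = 1})"
  shows "stopping_set R C H T"
proof -
  have "card {j \<in> T. H i j = 1} \<noteq> 1" if "i \<in> R" for i
    using assms(2)[OF that] by auto
  then show ?thesis
    using assms(1) by (simp add: stopping_set_def)
qed

text \<open>The sum in \<open>bit\<close> counts the common ones of \<open>h\<close> and
  \<open>D\<close> modulo 2.\<close>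

lemma parity_check_iff_even:
  assumes "finite C" "D \<subseteq> C"
  shows "(\<Sum>j\<in>C. h j * (if j \<in> D then 1 else 0)) = (0::bit) \<longleftrightarrow> even (card {j \<in> D. h j = 1})"
proof -
  have "h j * (if j \<in> D then 1 else 0) = (if j \<in> D \<and> h j = 1 then 1 else (0::bit))" for j
    by (cases "h j") auto
  then have "(\<Sum>j\<in>C. h j * (if j \<in> D then 1 else 0)) = (\<Sum>j\<in>C. if j \<in> D \<and> h j = 1 then 1 else (0::bit))"
    by simp
  also have "\<dots> = (\<Sum>j\<in>{j\<in>C. j \<in> D \<and> h j = 1}. 1)"
    using assms(1) by (rule sum.inter_filter[symmetric])
  also have "{j\<in>C. j \<in> D \<and> h j = 1} = {j \<in> D. h j = 1}"
    using assms(2) by blast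
  finally have "(\<Sum>j\<in>C. h j * (if j \<in> D then 1 else 0)) = (of_nat (card {j \<in> D. h j = 1}) :: bit)"
    by simp
  then show ?thesis
    by (cases "even (card {j \<in> D. h j = 1})") (auto elim!: evenE oddE)
qed

text \<open>Serves to turn a set of lines into a codeword; the restriction to \<open>C\<close> makes
  the indicator extensional, as \<open>null_code\<close> demands.\<close>

lemma indicator_mem_null_code_iff:
  assumes "finite C" "D \<subseteq> C"
  shows "(\<lambda>j\<in>C. if j \<in> D then 1 else 0) \<in> null_code R C H
    \<longleftrightarrow> (\<forall>i\<in>R. even (card {j \<in> D. H i j = 1}))"
proof -
  have "(\<Sum>j\<in>C. H i j * (\<lambda>j\<in>C. if j \<in> D then 1 else 0) j)
      = (\<Sum>j\<in>C. H i j * (if j \<in> D then 1 else 0))" for i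
    by (rule sum.cong) auto
  then show ?thesis
    unfolding null_code_def using parity_check_iff_even[OF assms] by (simp del: restrict_apply)
qed

text \<open>In \<open>bit\<close>, \<open>x j + y j\<close> is 1 exactly where the words differ, and
  the checks are additive.\<close>

lemma codeword_difference_even:
  assumes "finite C" "x \<in> null_code R C H" "y \<in> null_code R C H" "i \<in> R"
  shows "even (card {j \<in> {j \<in> C. x j \<noteq> y j}. H i j = 1})"
proof -
  have "x j + y j = (if j \<in> {j \<in> C. x j \<noteq> y j} then 1 else 0)" if "j \<in> C" for j
    using that by (cases "x j"; cases "y j") auto
  then have "(\<Sum>j\<in>C. H i j * (if j \<in> {j \<in> C. x j \<noteq> y j} then 1 else 0))
      = (\<Sum>j\<in>C. H i j * (x j + y j))"
    by (intro sum.cong) auto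
  also have "\<dots> = (\<Sum>j\<in>C. H i j * x j) + (\<Sum>j\<in>C. H i j * y j)"
    by (simp only: distrib_left sum.distrib)
  also have "\<dots> = 0"
    using assms by (simp add: null_code_def)
  finally show ?thesis
    using parity_check_iff_even[OF assms(1), of "{j \<in> C. x j \<noteq> y j}" "H i"] by blast
qed


section \<open>The grid\<close>

lemma grid_exists:
  assumes "CARD('n::finite) \<ge> 2"
  obtains T :: "('a::{field,finite}^'n^'n) set set"
  where "T \<subseteq> sym_lines" "card T = 2 * CARD('a)" "\<And>P. even (card {L \<in> T. P \<in> L})"
proof -
  obtain i j :: 'n where ij: "i \<noteq> j"
    using assms by (metis card_2_iff' ex_card iso_tuple_UNIV_I)
  define v :: "'a^'n" where "v = axis i 1"
  define w :: "'a^'n" where "w = axis j 1"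
  \<comment> \<open>\<open>G x y\<close> is diagonal, with \<open>x\<close> at position
    \<open>i\<close> and \<open>y\<close> at position \<open>j\<close>; the lines \<open>A y\<close>
    and \<open>B x\<close> are the two parallel classes of the grid.\<close>
  define G where "G x y = sym_outer x v + sym_outer y w" for x y
  define A where "A y = range (\<lambda>x. G x y)" for y
  define B where "B x = range (\<lambda>y. G x y)" for x
  have v: "v \<noteq> 0" and w: "w \<noteq> 0"
    by (auto simp: v_def w_def)
  have G: "G x y = G x' y' \<longleftrightarrow> x = x' \<and> y = y'" for x y x' y'
  proof -
    have "G x y $ i $ i = x" "G x y $ j $ j = y" for x y
      using ij by (simp_all add: G_def v_def w_def axis_def)
    then show ?thesis by metis
  qed
  have "A y = sym_line (sym_outer y w) v" for y
    by (simp add: A_def G_def sym_line_def add.commute)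
  moreover have "B x = sym_line (sym_outer x v) w" for x
    by (simp add: B_def G_def sym_line_def)
  ultimately have lines: "range A \<union> range B \<subseteq> sym_lines"
    using is_line_sym_line[OF sym_outer_points v] is_line_sym_line[OF sym_outer_points w]
    by (auto simp: sym_lines_def)
  have mem: "P \<in> A y \<longleftrightarrow> (\<exists>x. P = G x y)" "P \<in> B x \<longleftrightarrow> (\<exists>y. P = G x y)" for P x y
    by (auto simp: A_def B_def)
  \<comment> \<open>\<open>G (x + 1) y\<close> lies on \<open>A y\<close>, but could lie on
    \<open>B x\<close> only if \<open>x + 1 = x\<close>.\<close>
  have AB: "A y \<noteq> B x" for x y
  proof
    assume "A y = B x"
    moreover have "G (x + 1) y \<in> A y"
      by (auto simp: mem)
    ultimately show False
      by (auto simp: mem G)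
  qed
  have inj: "inj A" "inj B"
    unfolding inj_def by (metis mem G)+
  have "card (range A \<union> range B) = card (range A) + card (range B)"
    using AB by (intro card_Un_disjoint) auto
  then have card: "card (range A \<union> range B) = 2 * CARD('a)"
    using inj by (simp add: card_image)
  \<comment> \<open>A grid point lies on one line of each class, any other matrix on none, so the
    count is 2 or 0.\<close>
  have "even (card {L \<in> range A \<union> range B. P \<in> L})" for P
  proof (cases "\<exists>x y. P = G x y")
    case True
    then obtain x y where "P = G x y" by blast
    then have "{L \<in> range A \<union> range B. P \<in> L} = {A y, B x}"
      by (auto simp: mem G)
    then show ?thesis
      using AB by simp
  next
    case False
    then have "{L \<in> range A \<union> range B. P \<in> L} = {}"
      by (auto simp: mem)
    then show ?thesis
      by (simp only: card.empty even_zero)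
  qed
  then show thesis
    using that lines card by blast
qed

theorem theorem3:
  fixes q n :: nat
  assumes "primepow q" and "CARD('a::{field,finite}) = q"
    and "CARD('n::finite) = n" and "n \<ge> 2"
  shows "min_distance sym_lines (code_T :: (('a ^'n^'n) set \<Rightarrow> bit) set) = 2 * q \<and>
         stopping_distance (sym_points :: ('a ^'n^'n) set) sym_lines
           (mat_transpose incidence) = 2 * q"
proof
  let ?L = "sym_lines :: ('a^'n^'n) set set"
  let ?H = "mat_transpose incidence :: 'a^'n^'n \<Rightarrow> ('a^'n^'n) set \<Rightarrow> bit"
  \<comment> \<open>The same grid attains both minima: as a stopping set and as the support of a
    codeword.\<close>
  obtain T :: "('a^'n^'n) set set" where T: "T \<subseteq> sym_lines" "card T = 2 * q"
    "\<And>P. even (card {L \<in> T. P \<in> L})"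
  proof -
    have "CARD('n) \<ge> 2"
      using assms by simp
    then show thesis
      using that assms(2) by (elim grid_exists[where 'a = 'a]) simp
  qed
  have H: "?H P L = 1 \<longleftrightarrow> P \<in> L" for P L
    by (simp add: mat_transpose_def incidence_def)
  have q: "q > 0"
    using assms(2) by auto
  have fin: "finite ?L"
    by simp
  have ge: "2 * q \<le> card D" if "stopping_set sym_points ?L ?H D" "D \<noteq> {}" for D
    using stopping_set_card_ge[OF that] assms(2) by simp
  show "stopping_distance (sym_points :: ('a^'n^'n) set) ?L ?H = 2 * q"
    unfolding stopping_distance_def
  proof (rule cInf_eq_minimum)
    have "stopping_set sym_points ?L ?H T"
      using T by (intro even_card_stopping_set) (simp_all add: H)
    moreover have "T \<noteq> {}"
      using T(2) q by auto
    ultimately show "2 * q \<in> {card T |T. stopping_set sym_points ?L ?H T \<and> T \<noteq> {}}"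
      using T(2)[symmetric] by blast
  qed (use ge in auto)
  show "min_distance ?L code_T = 2 * q"
    unfolding min_distance_def
  proof (rule cInf_eq_minimum)
    \<comment> \<open>\<open>word {}\<close> vanishes on all lines, so its distance from
      \<open>word T\<close> is the weight \<open>card T\<close>.\<close>
    define word :: "('a^'n^'n) set set \<Rightarrow> ('a^'n^'n) set \<Rightarrow> bit"
      where "word D = (\<lambda>L\<in>?L. if L \<in> D then 1 else 0)" for D
    have words: "word D \<in> code_T" if "D \<subseteq> ?L" "\<And>P. even (card {L \<in> D. P \<in> L})" for D
      unfolding code_T_def word_def indicator_mem_null_code_iff[OF fin that(1)] H
      using that(2) by blast
    have "{L \<in> ?L. word T L \<noteq> word {} L} = T"
      using T(1) by (auto simp: word_def)
    then have d: "hamming_dist ?L (word T) (word {}) = 2 * q"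
      by (simp add: hamming_dist_def T(2))
    then have "word T \<noteq> word {}"
      using q by (auto simp: hamming_dist_def)
    then show "2 * q \<in> {hamming_dist ?L x y |x y. x \<in> code_T \<and> y \<in> code_T \<and> x \<noteq> y}"
      using d words[of T] words[of "{}"] T(1,3)
      by (intro CollectI exI[of _ "word T"] exI[of _ "word {}"]) simp
  next
    fix k
    assume "k \<in> {hamming_dist ?L x y |x y. x \<in> code_T \<and> y \<in> code_T \<and> x \<noteq> y}"
    then obtain x y where xy: "x \<in> code_T" "y \<in> code_T" "x \<noteq> y" "k = hamming_dist ?L x y"
      by blast
    let ?D = "{L \<in> ?L. x L \<noteq> y L}"
    \<comment> \<open>Every point lies on an even number of the lines where \<open>x\<close> and
      \<open>y\<close> differ; this brings the distance under the bound \<open>ge\<close>.\<close>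
    have "stopping_set sym_points ?L ?H ?D"
    proof (rule even_card_stopping_set)
      show "even (card {L \<in> ?D. ?H P L = 1})" if "P \<in> sym_points" for P
        by (rule codeword_difference_even[OF fin xy(1,2)[unfolded code_T_def] that])
    qed blast
    \<comment> \<open>Codewords are extensional, so agreement on all lines would make them
      equal.\<close>
    moreover have "?D \<noteq> {}"
    proof
      assume "?D = {}"
      then have "x = y"
        using xy(1,2) unfolding code_T_def null_code_def
        by (intro PiE_ext[of x ?L "\<lambda>_. UNIV" y]) auto
      then show False
        using xy(3) by blast
    qed
    ultimately show "2 * q \<le> k"
      using ge xy(4) by (simp add: hamming_dist_def)
  qed
qed

end
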